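(* Let $A_1,\dots,A_m$ be homogeneous configurations, where $A_j$ has $J_j$ columns, and let $\mathcal{B}_{A_j}$ be a Markov basis for $A_j$, $j=1,\dots,m$. Then the set consisting of (i) all square-free degree two moves for the complete independence model of $J_1\times\dots\times J_m$ contingency tables, and (ii) all moves $z^{A_j}(\mathbf{k}_1,\dots,\mathbf{k}_{\deg z^{A_j}})$ with $j\in\{1,\dots,m\}$, $z^{A_j}\in\mathcal{B}_{A_j}$ and $\mathbf{k}_1,\dots,\mathbf{k}_{\deg z^{A_j}}\in\bar{\mathcal{J}}_j$, is a Markov basis for the Segre product $A_1\otimes\dots\otimes A_m$.
   Context: Configurations and Markov bases: for an integer matrix $C$ with columns indexed by a finite set $\mathcal{I}$ of cells, a table is a vector $x\in\mathbb{Z}_{\ge0}^{\mathcal I}$, a move is $z\in\mathbb{Z}^{\mathcal I}$ with $Cz=0$, and the fiber of $t$ is $\{x\in\mathbb{Z}_{\ge 0}^{\mathcal I}: Cx=t\}$. A Markov basis for $C$ is a finite set $\mathcal{B}$ of moves such that any two tables in the same fiber (for every fiber) can be joined by a finite sequence of tables in that fiber in which consecutive tables differ by $\pm z$ for some $z\in\mathcal{B}$. A configuration $C$ is homogeneous if there is a vector $w$ with $\langle w,\mathbf{c}\rangle=1$ for every column $\mathbf{c}$ of $C$. Segre product: writing $[J]=\{1,\dots,J\}$, $A_1\otimes\dots\otimes A_m$ is the matrix whose columns are indexed by the cells $(i_1,\dots,i_m)\in[J_1]\times\dots\times[J_m]$, the column of $(i_1,\dots,i_m)$ being the vertical concatenation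 of the $i_1$-th column of $A_1$, the $i_2$-th column of $A_2$, ..., and the $i_m$-th column of $A_m$. Complete independence model: its moves are the integer $J_1\times\dots\times J_m$ arrays all of whose one-dimensional marginals are zero. A square-free degree two move is such a move of the form $\mathbf{e}_{a}+\mathbf{e}_{b}-\mathbf{e}_{c}-\mathbf{e}_{d}$ with $a,b,c,d$ distinct cells ($\mathbf{e}_a$ is the array with $1$ at cell $a$ and $0$ elsewhere). Notation: $\bar{\mathcal J}_j=[J_1]\times\dots\times[J_{j-1}]\times[J_{j+1}]\times\dots\times[J_m]$. For a move $z^{A_j}$ of $A_j$, $\deg z^{A_j}$ is the sum of its positive entries (equal to minus the sum of its negative entries, by homogeneity). Write uniquely $z^{A_j}=\sum_{h=1}^{\deg z^{A_j}}(\mathbf{e}_{j_h}-\mathbf{e}_{j'_h})$ with $j_1\le j_2\le\cdots$ listing the cells of the positive part with multiplicity and $j'_1\le j'_2\le\cdots$ those of the negative part. For $\mathbf{k}_1,\dots,\mathbf{k}_{\deg z^{A_j}}\in\bar{\mathcal J}_j$ define $$z^{A_j}(\mathbf{k}_1,\dots,\mathbf{k}_{\deg z^{A_j}})=\sum_{h=1}^{\deg z^{A_j}}(\mathbf{e}_{j_h\mathbf{k}_h}-\mathbf{e}_{j'_h\mathbf{k}_h}),$$ where $\mathbf{e}_{i\mathbf{k}}$ is the $m$-way table with $1$ at the cell whose $j$-th coordinate is $i$ and whose remaining coordinates are given by $\mathbf{k}$, and $0$ everywhere else. *)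

theory Defs
  imports Complex_Main "HOL-Library.FuncSet" "HOL-Library.Function_Algebras"
begin

(* An integer matrix with arbitrary index sets. Only the values of entry on
   rows \<times> cells are ever used. *)
record ('r, 'i) config =
  rows :: "'r set"
  cells :: "'i set"
  entry :: "'r \<Rightarrow> 'i \<Rightarrow> int"

definition configuration :: "('r, 'i) config \<Rightarrow> bool" where
  "configuration C \<longleftrightarrow> finite (rows C) \<and> finite (cells C)"

definition homogeneous :: "('r, 'i) config \<Rightarrow> bool" where
  "homogeneous C \<longleftrightarrow>
     (\<exists>w :: 'r \<Rightarrow> real. \<forall>i\<in>cells C. (\<Sum>r\<in>rows C. w r * of_int (entry C r i)) = 1)"

(* Vectors indexed by a set I are total functions that vanish outside I, so that
   equality of functions is equality of vectors. *)
definition int_vectors :: "'i set \<Rightarrow> ('i \<Rightarrow> int) set" where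
  "int_vectors I = {z. \<forall>i. i \<notin> I \<longrightarrow> z i = 0}"

definition tables :: "'i set \<Rightarrow> ('i \<Rightarrow> int) set" where
  "tables I = {x \<in> int_vectors I. \<forall>i\<in>I. 0 \<le> x i}"

definition mat_apply :: "('r, 'i) config \<Rightarrow> ('i \<Rightarrow> int) \<Rightarrow> 'r \<Rightarrow> int" where
  "mat_apply C z r = (\<Sum>i\<in>cells C. entry C r i * z i)"

definition moves :: "('r, 'i) config \<Rightarrow> ('i \<Rightarrow> int) set" where
  "moves C = {z \<in> int_vectors (cells C). \<forall>r\<in>rows C. mat_apply C z r = 0}"

definition fiber :: "('r, 'i) config \<Rightarrow> ('r \<Rightarrow> int) \<Rightarrow> ('i \<Rightarrow> int) set" where
  "fiber C t = {x \<in> tables (cells C). \<forall>r\<in>rows C. mat_apply C x r = t r}"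

definition step :: "('i \<Rightarrow> int) set \<Rightarrow> ('i \<Rightarrow> int) set \<Rightarrow> (('i \<Rightarrow> int) \<times> ('i \<Rightarrow> int)) set" where
  "step F B = {(x, y). x \<in> F \<and> y \<in> F \<and> (\<exists>z\<in>B. y = x + z \<or> y = x - z)}"

definition markov_basis :: "('r, 'i) config \<Rightarrow> ('i \<Rightarrow> int) set \<Rightarrow> bool" where
  "markov_basis C B \<longleftrightarrow> finite B \<and> B \<subseteq> moves C \<and>
     (\<forall>t. \<forall>x\<in>fiber C t. \<forall>y\<in>fiber C t. (x, y) \<in> (step (fiber C t) B)\<^sup>*)"

(* Cells of m-way tables are extensional functions on {1..m}. Vertical
   concatenation of columns: the row set is the disjoint union of the row sets. *)
definition segre :: "nat \<Rightarrow> (nat \<Rightarrow> ('r, 'i) config) \<Rightarrow> (nat \<times> 'r, nat \<Rightarrow> 'i) config" where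
  "segre m A =
     \<lparr>rows = (SIGMA j:{1..m}. rows (A j)),
      cells = (\<Pi>\<^sub>E j\<in>{1..m}. cells (A j)),
      entry = (\<lambda>(j, r) i. entry (A j) r (i j))\<rparr>"

definition unit_table :: "'i \<Rightarrow> 'i \<Rightarrow> int" where
  "unit_table a = (\<lambda>i. if i = a then 1 else 0)"

definition mcells :: "nat \<Rightarrow> (nat \<Rightarrow> nat) \<Rightarrow> (nat \<Rightarrow> nat) set" where
  "mcells m J = (\<Pi>\<^sub>E j\<in>{1..m}. {1..J j})"

definition marginal ::
    "nat \<Rightarrow> (nat \<Rightarrow> nat) \<Rightarrow> ((nat \<Rightarrow> nat) \<Rightarrow> int) \<Rightarrow> nat \<Rightarrow> nat \<Rightarrow> int" where
  "marginal m J z j a = (\<Sum>i | i \<in> mcells m J \<and> i j = a. z i)"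

definition indep_moves :: "nat \<Rightarrow> (nat \<Rightarrow> nat) \<Rightarrow> ((nat \<Rightarrow> nat) \<Rightarrow> int) set" where
  "indep_moves m J =
     {z \<in> int_vectors (mcells m J). \<forall>j\<in>{1..m}. \<forall>a\<in>{1..J j}. marginal m J z j a = 0}"

definition squarefree_deg2_moves :: "nat \<Rightarrow> (nat \<Rightarrow> nat) \<Rightarrow> ((nat \<Rightarrow> nat) \<Rightarrow> int) set" where
  "squarefree_deg2_moves m J =
     {z \<in> indep_moves m J. \<exists>a b c d. {a, b, c, d} \<subseteq> mcells m J \<and> distinct [a, b, c, d] \<and>
        z = unit_table a + unit_table b - unit_table c - unit_table d}"

definition other_indices :: "nat \<Rightarrow> (nat \<Rightarrow> nat) \<Rightarrow> nat \<Rightarrow> (nat \<Rightarrow> nat) set" where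
  "other_indices m J j = (\<Pi>\<^sub>E l\<in>{1..m} - {j}. {1..J l})"

definition deg :: "nat \<Rightarrow> (nat \<Rightarrow> int) \<Rightarrow> nat" where
  "deg n z = (\<Sum>i\<in>{1..n}. nat (z i))"

(* The nondecreasing list of the cells of the positive part of z, each cell i
   with z i > 0 repeated z i times; nat truncates negative values to 0. *)
definition pos_list :: "nat \<Rightarrow> (nat \<Rightarrow> int) \<Rightarrow> nat list" where
  "pos_list n z = concat (map (\<lambda>i. replicate (nat (z i)) i) [1..<Suc n])"

definition neg_list :: "nat \<Rightarrow> (nat \<Rightarrow> int) \<Rightarrow> nat list" where
  "neg_list n z = pos_list n (- z)"

(* k is the sequence of the remaining coordinates, numbered from 0; k(j := i)
   is the cell obtained by inserting i as j-th coordinate. The list neg_list n z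
   also has length deg n z when z is a move of a homogeneous configuration. *)
definition lift_move ::
    "nat \<Rightarrow> nat \<Rightarrow> (nat \<Rightarrow> int) \<Rightarrow> (nat \<Rightarrow> nat \<Rightarrow> nat) \<Rightarrow> (nat \<Rightarrow> nat) \<Rightarrow> int" where
  "lift_move n j z k =
     (\<Sum>h<deg n z. unit_table ((k h)(j := pos_list n z ! h))
                 - unit_table ((k h)(j := neg_list n z ! h)))"

end

theory Submission imports Defs "HOL-Library.Multiset" begin

text \<open>
  A nonnegative table is a multiset of cells, one element per counted individual. In this
  picture the \<open>j\<close>-th marginal is the image of the multiset under the \<open>j\<close>-th coordinate, and
  the Segre product sees a table only through its marginals: block \<open>j\<close> of its sufficient
  statistic is the statistic of \<open>A\<^sub>j\<close> at the \<open>j\<close>-th marginal (\<open>mat_apply_segre\<close>). Hence two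
  tables lie in the same fiber exactly if, for every \<open>j\<close>, their \<open>j\<close>-th marginals lie in the same
  fiber of \<open>A\<^sub>j\<close>. A walk from \<open>X\<close> to \<open>Y\<close> is then built in two stages.

  The first stage makes all marginals equal to those of \<open>Y\<close>, one coordinate after another
  (\<open>walk_to_prescribed_marginals\<close>). The Markov basis of \<open>A\<^sub>j\<close> joins the \<open>j\<close>-th marginal of \<open>X\<close> to
  that of \<open>Y\<close>. A step of this walk takes away certain \<open>j\<close>-indices from the marginal and puts in
  equally many others, because \<open>A\<^sub>j\<close> is homogeneous. The indices taken away are \<open>j\<close>-th coordinates
  of actual elements of \<open>X\<close>. Giving these elements the new \<open>j\<close>-th coordinates while
  keeping their other coordinates \<open>k\<^sub>h\<close> is one lifted move. It keeps the table nonnegative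
  and leaves the other marginals unchanged, so coordinates already treated stay correct.

  The second stage joins tables with equal one-dimensional marginals
  (\<open>walk_between_tables_with_equal_marginals\<close>). Exchanging the \<open>l\<close>-th coordinates of two elements
  either does nothing or is a square-free move of degree two. Such exchanges
  assemble any given element of \<open>Y\<close> inside \<open>X\<close>, coordinate by coordinate; that
  element is removed from both tables and the argument repeated.
\<close>

section \<open>Tables as multisets of cells\<close>

definition table_of :: "'i multiset \<Rightarrow> 'i \<Rightarrow> int" where
  "table_of X = (\<lambda>i. int (count X i))"

abbreviation marg :: "nat \<Rightarrow> (nat \<Rightarrow> nat) multiset \<Rightarrow> nat multiset" where
  "marg j X \<equiv> image_mset (\<lambda>i. i j) X"

lemma table_of_empty [simp]: "table_of {#} = 0"
  by (simp add: table_of_def fun_eq_iff)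

lemma table_of_union: "table_of (X + Y) = table_of X + table_of Y"
  by (simp add: table_of_def fun_eq_iff)

lemma table_of_add_mset: "table_of (add_mset a X) = unit_table a + table_of X"
  by (simp add: table_of_def unit_table_def fun_eq_iff)

lemma table_of_inject [simp]: "table_of X = table_of Y \<longleftrightarrow> X = Y"
  by (simp add: table_of_def fun_eq_iff multiset_eq_iff)

lemma table_of_image_mset_set:
  "finite H \<Longrightarrow> table_of (image_mset f (mset_set H)) = (\<Sum>h\<in>H. unit_table (f h))"
  by (induction H rule: finite_induct) (simp_all add: table_of_add_mset)

lemma table_of_in_tables: "set_mset X \<subseteq> I \<Longrightarrow> table_of X \<in> tables I"
  by (auto simp: tables_def int_vectors_def table_of_def count_eq_zero_iff)

lemma tables_obtain_multiset:
  assumes "finite I" "x \<in> tables I"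
  obtains X where "set_mset X \<subseteq> I" "x = table_of X"
proof -
  define X where "X = Abs_multiset (\<lambda>i. nat (x i))"
  have "{i. 0 < nat (x i)} \<subseteq> I"
    using assms(2) by (force simp: tables_def int_vectors_def)
  then have "finite {i. 0 < nat (x i)}"
    using assms(1) finite_subset by blast
  then have c: "count X i = nat (x i)" for i
    by (simp add: X_def)
  have nn: "0 \<le> x i" for i
    using assms(2) by (cases "i \<in> I") (auto simp: tables_def int_vectors_def)
  have "x = table_of X"
    by (simp add: table_of_def fun_eq_iff c nn)
  moreover have "set_mset X \<subseteq> I"
  proof
    fix i assume "i \<in># X"
    then have "0 < nat (x i)" by (simp add: c flip: count_greater_zero_iff)
    then show "i \<in> I" using \<open>{i. 0 < nat (x i)} \<subseteq> I\<close> by blast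
  qed
  ultimately show thesis using that by blast
qed

lemma mat_apply_add: "mat_apply C (x + y) r = mat_apply C x r + mat_apply C y r"
  by (simp add: mat_apply_def distrib_left sum.distrib)

lemma mat_apply_diff: "mat_apply C (x - y) r = mat_apply C x r - mat_apply C y r"
  by (simp add: mat_apply_def right_diff_distrib sum_subtractf)

lemma mat_apply_table_of:
  assumes "finite (cells C)" "set_mset X \<subseteq> cells C"
  shows "mat_apply C (table_of X) r = (\<Sum>i\<in>#X. entry C r i)"
  using assms(2)
proof (induction X)
  case empty
  then show ?case by (simp add: mat_apply_def)
next
  case (add a X)
  have "mat_apply C (unit_table a) r = entry C r a"
    using add.prems assms(1) by (simp add: mat_apply_def unit_table_def if_distrib cong: if_cong)
  then show ?case
    unfolding table_of_add_mset mat_apply_add using add by simp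
qed

lemma finite_cells_segre:
  "(\<And>j. j \<in> {1..m} \<Longrightarrow> finite (cells (A j))) \<Longrightarrow> finite (cells (segre m A))"
  unfolding segre_def by (auto intro!: finite_PiE)

lemma marg_in_cells:
  "set_mset X \<subseteq> cells (segre m A) \<Longrightarrow> j \<in> {1..m} \<Longrightarrow> set_mset (marg j X) \<subseteq> cells (A j)"
  by (force simp: segre_def)

text \<open>
  The row \<open>(j, r)\<close> of the Segre product reads only the \<open>j\<close>-th coordinate of a cell, so
  summing it over the elements of \<open>X\<close> is the same as summing row \<open>r\<close> of \<open>A j\<close> over the image of
  \<open>X\<close> under that coordinate.
\<close>

lemma mat_apply_segre:
  assumes fin: "\<And>j. j \<in> {1..m} \<Longrightarrow> finite (cells (A j))"
    and X: "set_mset X \<subseteq> cells (segre m A)" and j: "j \<in> {1..m}"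
  shows "mat_apply (segre m A) (table_of X) (j, r) = mat_apply (A j) (table_of (marg j X)) r"
proof -
  have "mat_apply (segre m A) (table_of X) (j, r) = (\<Sum>i\<in>#X. entry (A j) r (i j))"
    using mat_apply_table_of[OF finite_cells_segre[OF fin] X] by (simp add: segre_def)
  also have "\<dots> = mat_apply (A j) (table_of (marg j X)) r"
    using mat_apply_table_of[OF fin[OF j] marg_in_cells[OF X j]]
    by (simp add: image_mset.compositionality o_def)
  finally show ?thesis .
qed

text \<open>
  Both kinds of basis elements are differences of two tables, so this reduces the membership
  of either kind in \<open>moves (segre m A)\<close> to a computation of marginals.
\<close>

lemma table_diff_in_moves_segre:
  assumes fin: "\<And>j. j \<in> {1..m} \<Longrightarrow> finite (cells (A j))"
    and X: "set_mset X \<subseteq> cells (segre m A)" and Y: "set_mset Y \<subseteq> cells (segre m A)"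
    and M: "\<And>j. j \<in> {1..m} \<Longrightarrow> table_of (marg j X) - table_of (marg j Y) \<in> moves (A j)"
  shows "table_of X - table_of Y \<in> moves (segre m A)"
proof -
  have "table_of X - table_of Y \<in> int_vectors (cells (segre m A))"
    using table_of_in_tables[OF X] table_of_in_tables[OF Y]
    by (simp add: tables_def int_vectors_def)
  moreover have "mat_apply (segre m A) (table_of X - table_of Y) s = 0"
    if s: "s \<in> rows (segre m A)" for s
  proof -
    obtain j r where jr: "s = (j, r)" "j \<in> {1..m}" "r \<in> rows (A j)"
      using s by (auto simp: segre_def)
    then show ?thesis
      using M[OF jr(2)] mat_apply_segre[OF fin X jr(2)] mat_apply_segre[OF fin Y jr(2)]
      by (simp add: mat_apply_diff moves_def)
  qed
  ultimately show ?thesis by (simp add: moves_def)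
qed

section \<open>Walks through nonnegative tables\<close>

text \<open>
  Adding a move does not change the sufficient statistic, so a walk started in a fiber
  can leave it only by becoming negative. All later walks are therefore constructed in the set of
  all tables, which is the same for every fiber and closed under addition.
\<close>

lemma walk_in_tables_is_walk_in_fiber:
  assumes "B \<subseteq> moves C" "(x, y) \<in> (step (tables (cells C)) B)\<^sup>*" "x \<in> fiber C t"
  shows "(x, y) \<in> (step (fiber C t) B)\<^sup>*"
proof -
  have "(x, y) \<in> (step (fiber C t) B)\<^sup>* \<and> y \<in> fiber C t"
    using assms(2)
  proof (induction rule: rtrancl_induct)
    case base
    then show ?case using assms(3) by simp
  next
    case (step y y')
    obtain z where z: "z \<in> B" "y' = y + z \<or> y' = y - z" and y': "y' \<in> tables (cells C)"
      using step.hyps(2) by (auto simp: step_def)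
    have "y' \<in> fiber C t"
      using step.IH z y' assms(1) by (auto simp: fiber_def moves_def mat_apply_add mat_apply_diff)
    then have "(y, y') \<in> step (fiber C t) B"
      using step.IH z by (auto simp: step_def)
    then show ?case using step.IH \<open>y' \<in> fiber C t\<close> by (meson rtrancl.rtrancl_into_rtrancl)
  qed
  then show ?thesis ..
qed

lemma walk_add_table:
  assumes "(x, y) \<in> (step (tables I) B)\<^sup>*" "u \<in> tables I"
  shows "(u + x, u + y) \<in> (step (tables I) B)\<^sup>*"
  using assms(1)
proof (induction rule: rtrancl_induct)
  case base
  then show ?case by simp
next
  case (step y y')
  have "(u + y, u + y') \<in> step (tables I) B"
    using step.hyps(2) assms(2)
    by (auto simp: step_def tables_def int_vectors_def add.assoc add_diff_eq intro!: bexI)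
  with step.IH show ?case by (meson rtrancl.rtrancl_into_rtrancl)
qed

lemma walk_mono:
  assumes "(x, y) \<in> (step F B)\<^sup>*" "B \<subseteq> B'"
  shows "(x, y) \<in> (step F B')\<^sup>*"
proof -
  have "step F B \<subseteq> step F B'" using assms(2) by (auto simp: step_def)
  then show ?thesis using assms(1) rtrancl_mono by blast
qed

section \<open>Tables with equal one-dimensional marginals\<close>

lemma finite_mcells: "finite (mcells m J)"
  by (simp add: mcells_def finite_PiE)

lemma marginal_table_of:
  assumes "set_mset X \<subseteq> mcells m J"
  shows "marginal m J (table_of X) j v = int (count (marg j X) v)"
proof -
  have "count (marg j X) v = (\<Sum>i | i \<in># X \<and> i j = v. count X i)"
    by (simp add: count_image_mset vimage_def Int_def conj_commute)
  also have "\<dots> = (\<Sum>i | i \<in> mcells m J \<and> i j = v. count X i)"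
    using assms by (intro sum.mono_neutral_left) (auto simp: finite_mcells count_eq_zero_iff)
  finally show ?thesis by (simp add: marginal_def table_of_def)
qed

lemma table_diff_in_indep_moves_iff:
  assumes X: "set_mset X \<subseteq> mcells m J" and Y: "set_mset Y \<subseteq> mcells m J"
  shows "table_of X - table_of Y \<in> indep_moves m J \<longleftrightarrow> (\<forall>j\<in>{1..m}. marg j X = marg j Y)"
proof -
  have iv: "table_of X - table_of Y \<in> int_vectors (mcells m J)"
    using table_of_in_tables[OF X] table_of_in_tables[OF Y] by (simp add: tables_def int_vectors_def)
  have md: "marginal m J (table_of X - table_of Y) j v
      = int (count (marg j X) v) - int (count (marg j Y) v)" for j v
    unfolding marginal_table_of[OF X, symmetric] marginal_table_of[OF Y, symmetric]
    by (simp add: marginal_def sum_subtractf)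
  have out: "count (marg j X) v = 0" "count (marg j Y) v = 0" if "j \<in> {1..m}" "v \<notin> {1..J j}" for j v
    using that X Y unfolding count_eq_zero_iff mcells_def by (force dest: PiE_mem)+
  show ?thesis
  proof
    assume "table_of X - table_of Y \<in> indep_moves m J"
    then have *: "count (marg j X) v = count (marg j Y) v" if "j \<in> {1..m}" "v \<in> {1..J j}" for j v
      using that by (auto simp: indep_moves_def md)
    show "\<forall>j\<in>{1..m}. marg j X = marg j Y"
      using * out by (metis multiset_eqI)
  next
    assume "\<forall>j\<in>{1..m}. marg j X = marg j Y"
    then show "table_of X - table_of Y \<in> indep_moves m J"
      using iv by (simp add: indep_moves_def md)
  qed
qed

lemma unit_quadruple_as_table_diff:
  "unit_table a + unit_table b - unit_table c - unit_table d = table_of {#a, b#} - table_of {#c, d#}"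
  by (simp add: table_of_add_mset algebra_simps)

lemma cells_segre:
  "(\<And>j. j \<in> {1..m} \<Longrightarrow> cells (A j) = {1..J j}) \<Longrightarrow> cells (segre m A) = mcells m J"
  by (auto simp: segre_def mcells_def intro!: PiE_cong)

lemma squarefree_moves_subset_moves_segre:
  assumes "\<And>j. j \<in> {1..m} \<Longrightarrow> cells (A j) = {1..J j}"
  shows "squarefree_deg2_moves m J \<subseteq> moves (segre m A)"
proof
  fix z assume z: "z \<in> squarefree_deg2_moves m J"
  have mc: "cells (segre m A) = mcells m J"
    by (rule cells_segre) (rule assms)
  obtain a b c d where abcd: "{a, b, c, d} \<subseteq> mcells m J"
    and zeq: "z = table_of {#a, b#} - table_of {#c, d#}"
    using z unfolding squarefree_deg2_moves_def unit_quadruple_as_table_diff by blast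
  have X: "set_mset {#a, b#} \<subseteq> mcells m J" and Y: "set_mset {#c, d#} \<subseteq> mcells m J"
    using abcd by auto
  have "z \<in> indep_moves m J" using z by (simp add: squarefree_deg2_moves_def)
  then have eq: "marg j {#a, b#} = marg j {#c, d#}" if "j \<in> {1..m}" for j
    using that unfolding zeq table_diff_in_indep_moves_iff[OF X Y] by blast
  have zero: "0 \<in> moves (A j)" for j
    by (simp add: moves_def int_vectors_def mat_apply_def)
  show "z \<in> moves (segre m A)"
    unfolding zeq
  proof (rule table_diff_in_moves_segre)
    show "finite (cells (A j))" if "j \<in> {1..m}" for j using assms that by simp
    show "table_of (marg j {#a, b#}) - table_of (marg j {#c, d#}) \<in> moves (A j)" if "j \<in> {1..m}" for j
      using eq[OF that] zero by simp
  qed (use X Y mc in auto)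
qed

lemma finite_squarefree_deg2_moves: "finite (squarefree_deg2_moves m J)"
proof -
  let ?M = "mcells m J"
  have "squarefree_deg2_moves m J \<subseteq>
    (\<lambda>(a, b, c, d). unit_table a + unit_table b - unit_table c - unit_table d) ` (?M \<times> ?M \<times> ?M \<times> ?M)"
  proof
    fix z assume "z \<in> squarefree_deg2_moves m J"
    then obtain a b c d where "{a, b, c, d} \<subseteq> ?M"
      and z: "z = unit_table a + unit_table b - unit_table c - unit_table d"
      unfolding squarefree_deg2_moves_def by blast
    then have "(a, b, c, d) \<in> ?M \<times> ?M \<times> ?M \<times> ?M" by simp
    then show "z \<in> (\<lambda>(a, b, c, d). unit_table a + unit_table b - unit_table c - unit_table d)
        ` (?M \<times> ?M \<times> ?M \<times> ?M)"
      by (rule rev_image_eqI) (simp only: z prod.case)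
  qed
  then show ?thesis by (rule finite_subset) (simp add: finite_mcells)
qed

text \<open>
  The table is unchanged if \<open>a\<close> and \<open>b\<close> agree in coordinate \<open>l\<close>, and also if they agree
  everywhere else, since then the swap only exchanges the roles of \<open>a\<close> and \<open>b\<close>. In all
  other cases the two old and the two new cells are distinct, and the swap is a single
  square-free move of degree two.
\<close>

lemma swap_coordinate_walk:
  assumes X: "set_mset (add_mset a (add_mset b X)) \<subseteq> mcells m J" and l: "l \<in> {1..m}"
  defines "X' \<equiv> add_mset (a(l := b l)) (add_mset (b(l := a l)) X)"
  shows "(table_of (add_mset a (add_mset b X)), table_of X')
      \<in> (step (tables (mcells m J)) (squarefree_deg2_moves m J))\<^sup>*"
    and "set_mset X' \<subseteq> mcells m J"
    and "marg j X' = marg j (add_mset a (add_mset b X))"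
proof -
  let ?a = "a(l := b l)" and ?b = "b(l := a l)"
  let ?X = "add_mset a (add_mset b X)"
  have ab: "?a \<in> mcells m J" "?b \<in> mcells m J"
    using X l by (auto simp: mcells_def PiE_iff extensional_def)
  then show X': "set_mset X' \<subseteq> mcells m J" using X by (auto simp: X'_def)
  have marg2: "marg j {#?a, ?b#} = marg j {#a, b#}" for j
    by (auto simp: add_mset_commute)
  show "marg j X' = marg j ?X" by (auto simp: X'_def add_mset_commute)
  show "(table_of ?X, table_of X') \<in> (step (tables (mcells m J)) (squarefree_deg2_moves m J))\<^sup>*"
  proof (cases "a l = b l \<or> ?a = b")
    case True
    then have "X' = ?X"
    proof
      assume "a l = b l"
      then have "?a = a" "?b = b" by (metis fun_upd_triv)+
      then show ?thesis by (simp add: X'_def)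
    next
      assume e: "?a = b"
      have "?b = ?a(l := a l)" by (simp only: e)
      then have "?b = a" by simp
      then show ?thesis unfolding X'_def e by (simp add: add_mset_commute)
    qed
    then show ?thesis by simp
  next
    case False
    then have dist: "distinct [?a, ?b, a, b]"
    proof -
      have "?b \<noteq> a"
      proof
        assume e: "?b = a"
        have "?a = ?b(l := b l)" by (simp only: e)
        then show False using False by simp
      qed
      moreover have "?a \<noteq> ?b" "?a \<noteq> a" "?b \<noteq> b" "a \<noteq> b"
        using False by (metis fun_upd_same)+
      ultimately show ?thesis using False by simp
    qed
    have sub: "set_mset {#?a, ?b#} \<subseteq> mcells m J" "set_mset {#a, b#} \<subseteq> mcells m J"
      using ab X by auto
    define z where "z = unit_table ?a + unit_table ?b - unit_table a - unit_table b"
    have "z \<in> indep_moves m J"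
      unfolding z_def unit_quadruple_as_table_diff table_diff_in_indep_moves_iff[OF sub]
      using marg2 by blast
    moreover have "{?a, ?b, a, b} \<subseteq> mcells m J" using ab X by auto
    ultimately have "z \<in> squarefree_deg2_moves m J"
      using dist z_def unfolding squarefree_deg2_moves_def by blast
    moreover have "table_of X' = table_of ?X + z"
      by (simp add: X'_def z_def table_of_add_mset algebra_simps)
    ultimately have "(table_of ?X, table_of X') \<in> step (tables (mcells m J)) (squarefree_deg2_moves m J)"
      using table_of_in_tables[OF X] table_of_in_tables[OF X'] unfolding step_def by blast
    then show ?thesis ..
  qed
qed

text \<open>
  Some element \<open>c\<close> is selected and turned into \<open>d\<close> one coordinate at a time: as long as
  \<open>c\<close> differs from \<open>d\<close> in coordinate \<open>l\<close>, the unchanged \<open>l\<close>-th marginal guarantees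
  that another element has the entry \<open>d l\<close> there and can trade it with \<open>c\<close>.
\<close>

lemma walk_to_table_containing_cell:
  assumes X: "set_mset X \<subseteq> mcells m J" and "X \<noteq> {#}"
    and d: "d \<in> mcells m J" and dX: "\<And>j. j \<in> {1..m} \<Longrightarrow> d j \<in># marg j X"
  obtains X' where "set_mset (add_mset d X') \<subseteq> mcells m J"
    "\<And>j. marg j (add_mset d X') = marg j X"
    "(table_of X, table_of (add_mset d X'))
       \<in> (step (tables (mcells m J)) (squarefree_deg2_moves m J))\<^sup>*"
proof -
  let ?S = "step (tables (mcells m J)) (squarefree_deg2_moves m J)"
  have "\<exists>c X'. set_mset (add_mset c X') \<subseteq> mcells m J \<and> (\<forall>j. marg j (add_mset c X') = marg j X)
      \<and> (table_of X, table_of (add_mset c X')) \<in> ?S\<^sup>* \<and> (\<forall>j\<in>{1..l}. c j = d j)"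
    if "l \<le> m" for l
    using that
  proof (induction l)
    case 0
    obtain c X' where "X = add_mset c X'" using \<open>X \<noteq> {#}\<close> by (meson multiset_cases)
    then show ?case using X by (intro exI[of _ c] exI[of _ X']) auto
  next
    case (Suc l)
    then obtain c X' where sub: "set_mset (add_mset c X') \<subseteq> mcells m J"
      and mg: "\<And>j. marg j (add_mset c X') = marg j X"
      and walk: "(table_of X, table_of (add_mset c X')) \<in> ?S\<^sup>*"
      and agree: "\<forall>j\<in>{1..l}. c j = d j"
      by auto
    have l: "Suc l \<in> {1..m}" using Suc.prems by simp
    show ?case
    proof (cases "c (Suc l) = d (Suc l)")
      case True
      then have "\<forall>j\<in>{1..Suc l}. c j = d j" using agree by (auto simp: le_Suc_eq)
      then show ?thesis using sub mg walk by blast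
    next
      case False
      have "d (Suc l) \<in># marg (Suc l) (add_mset c X')" using dX[OF l] mg by simp
      then obtain b where "b \<in># X'" and b: "b (Suc l) = d (Suc l)" using False by auto
      then obtain X'' where X'': "X' = add_mset b X''" by (meson multi_member_split)
      note swap = swap_coordinate_walk[OF sub[unfolded X''] l]
      let ?c = "c(Suc l := b (Suc l))" and ?b = "b(Suc l := c (Suc l))"
      have "\<forall>j\<in>{1..Suc l}. ?c j = d j" using agree b by (auto simp: le_Suc_eq)
      moreover have "(table_of X, table_of (add_mset ?c (add_mset ?b X''))) \<in> ?S\<^sup>*"
        using walk swap(1) unfolding X'' by (rule rtrancl_trans)
      moreover have "marg j (add_mset ?c (add_mset ?b X'')) = marg j X" for j
        using swap(3) mg unfolding X'' by metis
      ultimately show ?thesis using swap(2) by blast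
    qed
  qed
  from this[of m] obtain c X' where sub: "set_mset (add_mset c X') \<subseteq> mcells m J"
    and mg: "\<And>j. marg j (add_mset c X') = marg j X"
    and walk: "(table_of X, table_of (add_mset c X')) \<in> ?S\<^sup>*" and agree: "\<forall>j\<in>{1..m}. c j = d j"
    by auto
  have "c = d"
  proof (rule PiE_ext)
    show "c \<in> (\<Pi>\<^sub>E j\<in>{1..m}. {1..J j})" using sub by (simp add: mcells_def)
    show "d \<in> (\<Pi>\<^sub>E j\<in>{1..m}. {1..J j})" using d by (simp add: mcells_def)
  qed (use agree in blast)
  then show thesis using that sub mg walk by blast
qed

lemma walk_between_tables_with_equal_marginals:
  assumes "m \<ge> 1" "set_mset X \<subseteq> mcells m J" "set_mset Y \<subseteq> mcells m J"
    and "\<And>j. j \<in> {1..m} \<Longrightarrow> marg j X = marg j Y"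
  shows "(table_of X, table_of Y) \<in> (step (tables (mcells m J)) (squarefree_deg2_moves m J))\<^sup>*"
  using assms(2-)
proof (induction Y arbitrary: X)
  case empty
  \<comment> \<open>This is where \<open>m \<ge> 1\<close> matters: without a marginal nothing would fix the size of \<open>X\<close>.\<close>
  have "X = {#}" using empty.prems(3)[of 1] \<open>m \<ge> 1\<close> by simp
  then show ?case by simp
next
  case (add d Y)
  have ne: "X \<noteq> {#}" using add.prems(3)[of 1] \<open>m \<ge> 1\<close> by auto
  have "d j \<in># marg j X" if "j \<in> {1..m}" for j using add.prems(3)[OF that] by simp
  then obtain X' where X': "set_mset (add_mset d X') \<subseteq> mcells m J"
    "\<And>j. marg j (add_mset d X') = marg j X"
    "(table_of X, table_of (add_mset d X'))
       \<in> (step (tables (mcells m J)) (squarefree_deg2_moves m J))\<^sup>*"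
    using walk_to_table_containing_cell[OF add.prems(1) ne] add.prems(2) by (metis insert_subset set_mset_add_mset_insert)
  have "marg j X' = marg j Y" if "j \<in> {1..m}" for j
    using X'(2)[of j] add.prems(3)[OF that] by simp
  then have "(table_of X', table_of Y) \<in> (step (tables (mcells m J)) (squarefree_deg2_moves m J))\<^sup>*"
    using add.IH X'(1) add.prems(2) by simp
  moreover have "unit_table d \<in> tables (mcells m J)"
    using add.prems(2) table_of_in_tables[of "{#d#}"] by (simp add: table_of_add_mset)
  ultimately have "(table_of (add_mset d X'), table_of (add_mset d Y))
      \<in> (step (tables (mcells m J)) (squarefree_deg2_moves m J))\<^sup>*"
    unfolding table_of_add_mset by (rule walk_add_table)
  with X'(3) show ?case by (rule rtrancl_trans)
qed

section \<open>Lifting moves and walks of one factor\<close>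

lemma count_pos_list: "count (mset (pos_list n z)) i = (if i \<in> {1..n} then nat (z i) else 0)"
proof -
  have "count (mset (concat (map (\<lambda>i. replicate (f i) i) xs))) i = (if i \<in> set xs then f i else 0)"
    if "distinct xs" for f :: "nat \<Rightarrow> nat" and xs
    using that by (induction xs) auto
  from this[of "[1..<Suc n]" "\<lambda>i. nat (z i)"] show ?thesis
    unfolding pos_list_def by (auto simp: less_Suc_eq_le)
qed

lemma set_pos_list: "set (pos_list n z) \<subseteq> {1..n}"
  by (auto simp: pos_list_def)

lemma length_pos_list: "length (pos_list n z) = deg n z"
  unfolding deg_def pos_list_def
  by (simp add: length_concat o_def sum_list_distinct_conv_sum_set atLeastLessThanSuc_atLeastAtMost
        del: upt_Suc)

lemma table_of_pos_neg_list:
  assumes "z \<in> int_vectors {1..n}"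
  shows "table_of (mset (pos_list n z)) - table_of (mset (neg_list n z)) = z"
  using assms by (auto simp: fun_eq_iff table_of_def count_pos_list neg_list_def int_vectors_def)

text \<open>
  The weight \<open>w\<close> that homogeneity provides makes the vector of ones a linear combination of
  the rows, and a move is orthogonal to every row.
\<close>

lemma homogeneous_move_sum_zero:
  assumes "homogeneous C" "z \<in> moves C"
  shows "(\<Sum>i\<in>cells C. z i) = 0"
proof -
  obtain w :: "_ \<Rightarrow> real" where w: "\<And>i. i \<in> cells C \<Longrightarrow> (\<Sum>r\<in>rows C. w r * of_int (entry C r i)) = 1"
    using assms(1) unfolding homogeneous_def by blast
  have "of_int (\<Sum>i\<in>cells C. z i) = (\<Sum>i\<in>cells C. (\<Sum>r\<in>rows C. w r * of_int (entry C r i)) * of_int (z i))"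
    by (simp add: w)
  also have "\<dots> = (\<Sum>i\<in>cells C. \<Sum>r\<in>rows C. w r * of_int (entry C r i * z i))"
    by (simp add: sum_distrib_right mult.assoc)
  also have "\<dots> = (\<Sum>r\<in>rows C. \<Sum>i\<in>cells C. w r * of_int (entry C r i * z i))"
    by (rule sum.swap)
  also have "\<dots> = (\<Sum>r\<in>rows C. w r * of_int (mat_apply C z r))"
    by (simp add: mat_apply_def sum_distrib_left)
  also have "\<dots> = 0" using assms(2) by (simp add: moves_def)
  finally show ?thesis by (simp only: of_int_eq_0_iff)
qed

lemma length_neg_list:
  assumes "homogeneous C" "z \<in> moves C" "cells C = {1..n}"
  shows "length (neg_list n z) = deg n z"
proof -
  have "(\<Sum>i\<in>{1..n}. int (nat (z i)) - int (nat (- z i))) = (\<Sum>i\<in>{1..n}. z i)"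
    by (rule sum.cong) auto
  also have "\<dots> = 0" using homogeneous_move_sum_zero[OF assms(1,2)] assms(3) by simp
  finally have "int (deg n z) = int (deg n (- z))"
    by (simp add: deg_def sum_subtractf)
  then show ?thesis by (simp add: neg_list_def length_pos_list)
qed

lemma lift_move_as_table_diff:
  "lift_move n j z k =
     table_of (image_mset (\<lambda>h. (k h)(j := pos_list n z ! h)) (mset_set {..<deg n z}))
   - table_of (image_mset (\<lambda>h. (k h)(j := neg_list n z ! h)) (mset_set {..<deg n z}))"
  by (simp add: lift_move_def table_of_image_mset_set sum_subtractf)

lemma marg_lift:
  "marg j (image_mset (\<lambda>h. (k h)(j := p ! h)) (mset_set {..<length p})) = mset p"
proof -
  have "marg j (image_mset (\<lambda>h. (k h)(j := p ! h)) (mset_set {..<length p}))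
      = image_mset (\<lambda>h. p ! h) (mset_set {..<length p})"
    by (simp add: image_mset.compositionality o_def)
  also have "\<dots> = mset (map (\<lambda>h. p ! h) [0..<length p])"
    by (simp add: atLeast0LessThan del: map_nth)
  finally show ?thesis by (simp only: map_nth)
qed

lemma marg_lift_other:
  "l \<noteq> j \<Longrightarrow> marg l (image_mset (\<lambda>h. (k h)(j := p h)) H) = image_mset (\<lambda>h. k h l) H"
  by (simp add: image_mset.compositionality o_def)

lemma insert_coordinate_in_mcells:
  assumes "k \<in> other_indices m J j" "j \<in> {1..m}" "v \<in> {1..J j}"
  shows "k(j := v) \<in> mcells m J"
  using assms by (auto simp: other_indices_def mcells_def PiE_iff extensional_def)

lemma set_lift_subset_mcells:
  assumes "\<forall>h<length p. k h \<in> other_indices m J j" "j \<in> {1..m}" "set p \<subseteq> {1..J j}"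
  shows "set_mset (image_mset (\<lambda>h. (k h)(j := p ! h)) (mset_set {..<length p})) \<subseteq> mcells m J"
proof -
  have "(k h)(j := p ! h) \<in> mcells m J" if "h < length p" for h
    using insert_coordinate_in_mcells[of "k h"] assms that nth_mem[OF that] by blast
  then show ?thesis by auto
qed

lemma lift_move_in_moves_segre:
  assumes cells: "\<And>j. j \<in> {1..m} \<Longrightarrow> cells (A j) = {1..J j}"
    and hom: "homogeneous (A j)" and z: "z \<in> moves (A j)" and j: "j \<in> {1..m}"
    and k: "\<forall>h<deg (J j) z. k h \<in> other_indices m J j"
  shows "lift_move (J j) j z k \<in> moves (segre m A)"
proof -
  let ?p = "pos_list (J j) z" and ?q = "neg_list (J j) z"
  let ?P = "image_mset (\<lambda>h. (k h)(j := ?p ! h)) (mset_set {..<deg (J j) z})"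
  let ?N = "image_mset (\<lambda>h. (k h)(j := ?q ! h)) (mset_set {..<deg (J j) z})"
  have mc: "cells (segre m A) = mcells m J"
    by (rule cells_segre) (rule cells)
  have lp: "length ?p = deg (J j) z" by (rule length_pos_list)
  have lq: "length ?q = deg (J j) z" by (rule length_neg_list[OF hom z cells[OF j]])
  have sp: "set ?p \<subseteq> {1..J j}" and sq: "set ?q \<subseteq> {1..J j}"
    by (simp_all only: neg_list_def set_pos_list)
  have P: "set_mset ?P \<subseteq> mcells m J"
    using set_lift_subset_mcells[of ?p k m J j] k j sp unfolding lp by blast
  have N: "set_mset ?N \<subseteq> mcells m J"
    using set_lift_subset_mcells[of ?q k m J j] k j sq unfolding lq by blast
  have mP: "marg j ?P = mset ?p" using marg_lift[of j k ?p] unfolding lp .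
  have mN: "marg j ?N = mset ?q" using marg_lift[of j k ?q] unfolding lq .
  show ?thesis
    unfolding lift_move_as_table_diff
  proof (rule table_diff_in_moves_segre)
    show "finite (cells (A l))" if "l \<in> {1..m}" for l using cells[OF that] by simp
    show "set_mset ?P \<subseteq> cells (segre m A)" "set_mset ?N \<subseteq> cells (segre m A)"
      using P N mc by simp_all
    show "table_of (marg l ?P) - table_of (marg l ?N) \<in> moves (A l)" if l: "l \<in> {1..m}" for l
    proof (cases "l = j")
      case True
      have "z \<in> int_vectors {1..J j}" using z cells[OF j] by (simp add: moves_def)
      then show ?thesis
        unfolding True mP mN using z by (simp add: table_of_pos_neg_list)
    next
      case False
      then show ?thesis
        unfolding marg_lift_other[OF False] by (simp add: moves_def int_vectors_def mat_apply_def)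
    qed
  qed
qed

lemma mset_eq_image_mset_obtain_list:
  assumes "mset xs = image_mset f X"
  obtains ys where "mset ys = X" "map f ys = xs"
proof -
  have "\<exists>ys. mset ys = X \<and> map f ys = xs"
    using assms
  proof (induction xs arbitrary: X)
    case Nil
    then show ?case by simp
  next
    case (Cons a xs)
    then obtain X' b where "X = add_mset b X'" "f b = a" "image_mset f X' = mset xs"
      using msed_map_invR[of f X a "mset xs"] by auto
    then show ?case using Cons.IH[of X'] by (metis list.simps(9) mset.simps(2))
  qed
  then show thesis using that by blast
qed

text \<open>
  This is the core of the lifting. The indices \<open>p\<close> occur in the \<open>j\<close>-th marginal of \<open>X\<close>, so
  they are the \<open>j\<close>-th coordinates of distinct elements of the multiset \<open>X\<close>. The remaining
  coordinates of these elements are chosen as \<open>k\<close>; replacing \<open>p\<close> by \<open>q\<close> then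
  removes only cells that are present, so the result is again a multiset.
\<close>

lemma exchange_coordinates:
  assumes X: "set_mset X \<subseteq> mcells m J" and j: "j \<in> {1..m}"
    and len: "length p = length q" and q: "set q \<subseteq> {1..J j}"
    and eq: "marg j X = mset p + R"
  obtains k X' where "\<forall>h<length p. k h \<in> other_indices m J j" "set_mset X' \<subseteq> mcells m J"
    "marg j X' = mset q + R" "\<And>l. l \<noteq> j \<Longrightarrow> marg l X' = marg l X"
    "table_of X' = table_of X
      + (\<Sum>h<length p. unit_table ((k h)(j := q ! h)) - unit_table ((k h)(j := p ! h)))"
proof -
  obtain X0 X1 where X01: "X = X0 + X1" "mset p = marg j X0" "R = marg j X1"
    using image_mset_eq_plusD[OF eq] by blast
  obtain cs where cs: "mset cs = X0" "map (\<lambda>i. i j) cs = p"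
    using mset_eq_image_mset_obtain_list[OF X01(2)] by blast
  have lcs: "length cs = length p" using cs(2) by (metis length_map)
  have pj: "p ! h = (cs ! h) j" if "h < length p" for h
    using cs(2) lcs that by (metis nth_map)
  \<comment> \<open>Members of \<open>other_indices m J j\<close> take the value \<open>undefined\<close> at \<open>j\<close>.\<close>
  define k where "k h = (cs ! h)(j := undefined)" for h
  define Q where "Q = image_mset (\<lambda>h. (k h)(j := q ! h)) (mset_set {..<length p})"
  have X0: "X0 = image_mset (\<lambda>h. (k h)(j := p ! h)) (mset_set {..<length p})"
  proof -
    have "image_mset (\<lambda>h. (k h)(j := p ! h)) (mset_set {..<length p})
        = image_mset (\<lambda>h. cs ! h) (mset_set {..<length p})"
      by (rule image_mset_cong) (simp add: k_def pj)
    also have "\<dots> = mset (map (\<lambda>h. cs ! h) [0..<length p])"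
      by (simp add: atLeast0LessThan del: map_nth)
    also have "\<dots> = X0" using cs(1) lcs by (metis map_nth)
    finally show ?thesis ..
  qed
  have k: "\<forall>h<length p. k h \<in> other_indices m J j"
  proof (intro allI impI)
    fix h assume "h < length p"
    then have "cs ! h \<in># X" using lcs cs(1) X01(1) nth_mem by fastforce
    then have "cs ! h \<in> mcells m J" using X by blast
    then show "k h \<in> other_indices m J j"
      by (auto simp: k_def mcells_def other_indices_def PiE_iff extensional_def)
  qed
  have "set_mset (Q + X1) \<subseteq> mcells m J"
    using set_lift_subset_mcells[of q k m J j] k j q X unfolding Q_def len X01(1) by auto
  moreover have "marg j (Q + X1) = mset q + R"
    using marg_lift[of j k q] unfolding Q_def len X01(3) by simp
  moreover have "marg l (Q + X1) = marg l X" if "l \<noteq> j" for l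
    unfolding X01(1) X0 Q_def image_mset_union marg_lift_other[OF that] ..
  moreover have "table_of (Q + X1) = table_of X
      + (\<Sum>h<length p. unit_table ((k h)(j := q ! h)) - unit_table ((k h)(j := p ! h)))"
    unfolding X01(1) X0 Q_def table_of_union
    by (simp add: table_of_image_mset_set sum_subtractf)
  ultimately show thesis using that k by blast
qed

text \<open>
  Disjointness forces \<open>N\<close> to be contained in \<open>U\<close>: what is subtracted in a cell cannot be
  compensated by \<open>P\<close> in the same cell.
\<close>

lemma disjoint_exchange_decomposition:
  assumes "table_of V = table_of U + (table_of P - table_of N)" "P \<inter># N = {#}"
  obtains R where "U = N + R" "V = P + R"
proof -
  have c: "int (count V i) = int (count U i) + int (count P i) - int (count N i)" for i
    using fun_cong[OF assms(1), of i] by (simp add: table_of_def)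
  have d: "count P i = 0 \<or> count N i = 0" for i
    using arg_cong[OF assms(2), of "\<lambda>M. count M i"] by (simp add: min_def split: if_splits)
  have "N \<subseteq># U"
  proof (rule mset_subset_eqI)
    show "count N i \<le> count U i" for i using c[of i] d[of i] by linarith
  qed
  then obtain R where R: "U = N + R" by (auto simp: mset_subset_eq_exists_conv)
  have "V = P + R"
  proof (rule multiset_eqI)
    show "count V i = count (P + R) i" for i using c[of i] R by simp
  qed
  with R that show thesis by blast
qed

text \<open>
  A step may add or subtract \<open>z\<close>. The two cases take away the negative and the positive part of
  \<open>z\<close> from the marginal, respectively, and exchange it for the other part.
\<close>

lemma lift_step:
  assumes cells: "cells (A j) = {1..J j}" and hom: "homogeneous (A j)"
    and z: "z \<in> moves (A j)" and j: "j \<in> {1..m}" and X: "set_mset X \<subseteq> mcells m J"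
    and V: "table_of V = table_of (marg j X) + z \<or> table_of V = table_of (marg j X) - z"
  obtains k X' where "\<forall>h<deg (J j) z. k h \<in> other_indices m J j" "set_mset X' \<subseteq> mcells m J"
    "marg j X' = V" "\<And>l. l \<noteq> j \<Longrightarrow> marg l X' = marg l X"
    "table_of X' = table_of X + lift_move (J j) j z k \<or> table_of X' = table_of X - lift_move (J j) j z k"
proof -
  let ?p = "pos_list (J j) z" and ?q = "neg_list (J j) z"
  have lp: "length ?p = deg (J j) z" by (rule length_pos_list)
  have lq: "length ?q = deg (J j) z" by (rule length_neg_list[OF hom z cells])
  have sp: "set ?p \<subseteq> {1..J j}" and sq: "set ?q \<subseteq> {1..J j}"
    by (simp_all only: neg_list_def set_pos_list)
  have zeq: "z = table_of (mset ?p) - table_of (mset ?q)"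
    using z cells by (simp add: moves_def table_of_pos_neg_list)
  have disj: "mset ?p \<inter># mset ?q = {#}"
    by (auto simp: multiset_eq_iff count_pos_list neg_list_def)
  from V show thesis
  proof
    assume "table_of V = table_of (marg j X) + z"
    then obtain R where R: "marg j X = mset ?q + R" "V = mset ?p + R"
      using disjoint_exchange_decomposition disj zeq by metis
    obtain k X' where *: "\<forall>h<length ?q. k h \<in> other_indices m J j" "set_mset X' \<subseteq> mcells m J"
      "marg j X' = mset ?p + R" "\<And>l. l \<noteq> j \<Longrightarrow> marg l X' = marg l X"
      "table_of X' = table_of X
        + (\<Sum>h<length ?q. unit_table ((k h)(j := ?p ! h)) - unit_table ((k h)(j := ?q ! h)))"
      using exchange_coordinates[OF X j lq[folded lp] sp R(1)] by blast
    have "table_of X' = table_of X + lift_move (J j) j z k"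
      using *(5) by (simp only: lift_move_def lq)
    moreover have "\<forall>h<deg (J j) z. k h \<in> other_indices m J j" using *(1) unfolding lq .
    ultimately show thesis using that *(2-4) R(2) by blast
  next
    assume "table_of V = table_of (marg j X) - z"
    then have V': "table_of V = table_of (marg j X) + (table_of (mset ?q) - table_of (mset ?p))"
      using zeq by (metis diff_conv_add_uminus minus_diff_eq)
    obtain R where R: "marg j X = mset ?p + R" "V = mset ?q + R"
      using disjoint_exchange_decomposition[OF V'] disj by (metis inter_mset_def subset_mset.inf_commute)
    obtain k X' where *: "\<forall>h<length ?p. k h \<in> other_indices m J j" "set_mset X' \<subseteq> mcells m J"
      "marg j X' = mset ?q + R" "\<And>l. l \<noteq> j \<Longrightarrow> marg l X' = marg l X"
      "table_of X' = table_of X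
        + (\<Sum>h<length ?p. unit_table ((k h)(j := ?q ! h)) - unit_table ((k h)(j := ?p ! h)))"
      using exchange_coordinates[OF X j lp[folded lq] sq R(1)] by blast
    have "(\<Sum>h<length ?p. unit_table ((k h)(j := ?q ! h)) - unit_table ((k h)(j := ?p ! h)))
        = - lift_move (J j) j z k"
      by (simp add: lift_move_def lp sum_subtractf)
    then have "table_of X' = table_of X - lift_move (J j) j z k"
      using *(5) by simp
    moreover have "\<forall>h<deg (J j) z. k h \<in> other_indices m J j" using *(1) unfolding lp .
    ultimately show thesis using that *(2-4) R(2) by blast
  qed
qed

definition lifted_moves :: "nat \<Rightarrow> (nat \<Rightarrow> nat) \<Rightarrow> nat \<Rightarrow> (nat \<Rightarrow> int) set \<Rightarrow> ((nat \<Rightarrow> nat) \<Rightarrow> int) set" where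
  "lifted_moves m J j Z =
     {lift_move (J j) j z k | z k. z \<in> Z \<and> (\<forall>h<deg (J j) z. k h \<in> other_indices m J j)}"

text \<open>
  Infinitely many sequences \<open>k\<close> occur in the definition, but a lifted move depends only on the
  first \<open>deg (J j) z\<close> terms, and there are finitely many such initial segments.
\<close>

lemma finite_lifted_moves:
  assumes "finite Z"
  shows "finite (lifted_moves m J j Z)"
proof -
  have "lifted_moves m J j Z \<subseteq>
    (\<Union>z\<in>Z. lift_move (J j) j z ` (\<Pi>\<^sub>E h\<in>{..<deg (J j) z}. other_indices m J j))"
  proof
    fix u assume "u \<in> lifted_moves m J j Z"
    then obtain z k where u: "u = lift_move (J j) j z k" "z \<in> Z"
      "\<forall>h<deg (J j) z. k h \<in> other_indices m J j"
      by (auto simp: lifted_moves_def)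
    have "u = lift_move (J j) j z (restrict k {..<deg (J j) z})"
      unfolding u(1) lift_move_def by (rule sum.cong) auto
    moreover have "restrict k {..<deg (J j) z} \<in> (\<Pi>\<^sub>E h\<in>{..<deg (J j) z}. other_indices m J j)"
      using u(3) by auto
    ultimately show "u \<in> (\<Union>z\<in>Z. lift_move (J j) j z ` (\<Pi>\<^sub>E h\<in>{..<deg (J j) z}. other_indices m J j))"
      using u(2) by blast
  qed
  moreover have "finite (\<Union>z\<in>Z. lift_move (J j) j z ` (\<Pi>\<^sub>E h\<in>{..<deg (J j) z}. other_indices m J j))"
    using assms by (auto intro!: finite_PiE simp: other_indices_def)
  ultimately show ?thesis by (rule finite_subset)
qed

lemma lift_walk:
  assumes cells: "cells (A j) = {1..J j}" and hom: "homogeneous (A j)"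
    and Z: "Z \<subseteq> moves (A j)" and j: "j \<in> {1..m}" and X: "set_mset X \<subseteq> mcells m J"
    and walk: "(table_of (marg j X), table_of V) \<in> (step (fiber (A j) t) Z)\<^sup>*"
  obtains X' where "set_mset X' \<subseteq> mcells m J" "marg j X' = V" "\<And>l. l \<noteq> j \<Longrightarrow> marg l X' = marg l X"
    "(table_of X, table_of X') \<in> (step (tables (mcells m J)) (lifted_moves m J j Z))\<^sup>*"
proof -
  let ?S = "step (tables (mcells m J)) (lifted_moves m J j Z)"
  have "\<exists>X'. set_mset X' \<subseteq> mcells m J \<and> table_of (marg j X') = v \<and> (\<forall>l. l \<noteq> j \<longrightarrow> marg l X' = marg l X)
     \<and> (table_of X, table_of X') \<in> ?S\<^sup>*" if "(table_of (marg j X), v) \<in> (step (fiber (A j) t) Z)\<^sup>*" for v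
    using that
  proof (induction rule: rtrancl_induct)
    case base
    then show ?case using X by blast
  next
    case (step v v')
    then obtain X' where X': "set_mset X' \<subseteq> mcells m J" "table_of (marg j X') = v"
      "\<And>l. l \<noteq> j \<Longrightarrow> marg l X' = marg l X" "(table_of X, table_of X') \<in> ?S\<^sup>*"
      by auto
    obtain z where z: "z \<in> Z" "v' = v + z \<or> v' = v - z" and "v' \<in> tables {1..J j}"
      using step.hyps(2) cells by (auto simp: step_def fiber_def)
    then obtain V' where V': "v' = table_of V'"
      using tables_obtain_multiset by blast
    have zm: "z \<in> moves (A j)" using z(1) Z by blast
    have V'_step: "table_of V' = table_of (marg j X') + z \<or> table_of V' = table_of (marg j X') - z"
      using z(2) unfolding V' X'(2) .
    obtain k X'' where X'': "\<forall>h<deg (J j) z. k h \<in> other_indices m J j" "set_mset X'' \<subseteq> mcells m J"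
      "marg j X'' = V'" "\<And>l. l \<noteq> j \<Longrightarrow> marg l X'' = marg l X'"
      "table_of X'' = table_of X' + lift_move (J j) j z k \<or> table_of X'' = table_of X' - lift_move (J j) j z k"
      using lift_step[where A = A and J = J and V = V', OF cells hom zm j X'(1) V'_step] by blast
    have "lift_move (J j) j z k \<in> lifted_moves m J j Z"
      using X''(1) z(1) by (auto simp: lifted_moves_def)
    then have "(table_of X', table_of X'') \<in> ?S"
      using X''(5) table_of_in_tables[OF X'(1)] table_of_in_tables[OF X''(2)] by (auto simp: step_def)
    then have "(table_of X, table_of X'') \<in> ?S\<^sup>*"
      using X'(4) by (rule rtrancl.rtrancl_into_rtrancl[rotated])
    moreover have "\<forall>l. l \<noteq> j \<longrightarrow> marg l X'' = marg l X" using X''(4) X'(3) by metis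
    ultimately show ?case using X''(2,3) V' by blast
  qed
  from this[OF walk] that show thesis by auto
qed

text \<open>
  Lifting along coordinate \<open>j\<close> preserves every other marginal, so the coordinates can be
  corrected successively.
\<close>

lemma walk_to_prescribed_marginals:
  assumes cells: "\<And>j. j \<in> {1..m} \<Longrightarrow> cells (A j) = {1..J j}"
    and hom: "\<And>j. j \<in> {1..m} \<Longrightarrow> homogeneous (A j)"
    and mb: "\<And>j. j \<in> {1..m} \<Longrightarrow> markov_basis (A j) (B j)"
    and X: "set_mset X \<subseteq> mcells m J"
    and fX: "\<And>j. j \<in> {1..m} \<Longrightarrow> table_of (marg j X) \<in> fiber (A j) (t j)"
    and fV: "\<And>j. j \<in> {1..m} \<Longrightarrow> table_of (V j) \<in> fiber (A j) (t j)"
  obtains X' where "set_mset X' \<subseteq> mcells m J" "\<And>j. j \<in> {1..m} \<Longrightarrow> marg j X' = V j"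
    "(table_of X, table_of X')
      \<in> (step (tables (mcells m J)) (\<Union>j\<in>{1..m}. lifted_moves m J j (B j)))\<^sup>*"
proof -
  let ?L = "\<Union>j\<in>{1..m}. lifted_moves m J j (B j)"
  let ?S = "step (tables (mcells m J)) ?L"
  have "\<exists>X'. set_mset X' \<subseteq> mcells m J \<and> (\<forall>j\<in>{1..m}. marg j X' = (if j \<le> l then V j else marg j X))
      \<and> (table_of X, table_of X') \<in> ?S\<^sup>*" if "l \<le> m" for l
    using that
  proof (induction l)
    case 0
    show ?case using X by (intro exI[of _ X]) auto
  next
    case (Suc l)
    let ?j = "Suc l"
    obtain X' where X': "set_mset X' \<subseteq> mcells m J"
      "\<forall>j\<in>{1..m}. marg j X' = (if j \<le> l then V j else marg j X)" "(table_of X, table_of X') \<in> ?S\<^sup>*"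
      using Suc by auto
    have j: "?j \<in> {1..m}" using Suc.prems by simp
    have "marg ?j X' = marg ?j X" using X'(2) j by simp
    then have walk: "(table_of (marg ?j X'), table_of (V ?j)) \<in> (step (fiber (A ?j) (t ?j)) (B ?j))\<^sup>*"
      using mb[OF j] fX[OF j] fV[OF j] by (simp add: markov_basis_def)
    have Z: "B ?j \<subseteq> moves (A ?j)" using mb[OF j] by (simp add: markov_basis_def)
    obtain X'' where X'': "set_mset X'' \<subseteq> mcells m J" "marg ?j X'' = V ?j"
      "\<And>i. i \<noteq> ?j \<Longrightarrow> marg i X'' = marg i X'"
      "(table_of X', table_of X'') \<in> (step (tables (mcells m J)) (lifted_moves m J ?j (B ?j)))\<^sup>*"
      using lift_walk[where A = A and J = J, OF cells[OF j] hom[OF j] Z j X'(1) walk] by blast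
    have "lifted_moves m J ?j (B ?j) \<subseteq> ?L" using j by blast
    then have "(table_of X, table_of X'') \<in> ?S\<^sup>*"
      using X'(3) walk_mono[OF X''(4)] by (meson rtrancl_trans)
    moreover have "marg i X'' = (if i \<le> ?j then V i else marg i X)" if "i \<in> {1..m}" for i
      using X''(2,3) X'(2) that by (cases "i = ?j") auto
    ultimately show ?case using X''(1) by blast
  qed
  from this[of m] show thesis using that by auto
qed

theorem corollary1:
  fixes m :: nat and J :: "nat \<Rightarrow> nat"
    and A :: "nat \<Rightarrow> ('r, nat) config"
    and B :: "nat \<Rightarrow> (nat \<Rightarrow> int) set"
  assumes "m \<ge> 1"
    and "\<And>j. j \<in> {1..m} \<Longrightarrow> configuration (A j)"
    and "\<And>j. j \<in> {1..m} \<Longrightarrow> cells (A j) = {1..J j}"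
    and "\<And>j. j \<in> {1..m} \<Longrightarrow> homogeneous (A j)"
    and "\<And>j. j \<in> {1..m} \<Longrightarrow> markov_basis (A j) (B j)"
  shows "markov_basis (segre m A)
    (squarefree_deg2_moves m J \<union>
     {lift_move (J j) j z k | j z k.
        j \<in> {1..m} \<and> z \<in> B j \<and> (\<forall>h<deg (J j) z. k h \<in> other_indices m J j)})"
proof -
  note cells = assms(3) and hom = assms(4) and mb = assms(5)
  let ?Q = "squarefree_deg2_moves m J" and ?L = "\<Union>j\<in>{1..m}. lifted_moves m J j (B j)"
  have L: "{lift_move (J j) j z k | j z k.
        j \<in> {1..m} \<and> z \<in> B j \<and> (\<forall>h<deg (J j) z. k h \<in> other_indices m J j)} = ?L"
    unfolding lifted_moves_def by blast
  have mc: "cells (segre m A) = mcells m J"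
    by (rule cells_segre) (rule cells)
  have fin: "finite (cells (A j))" if "j \<in> {1..m}" for j using cells[OF that] by simp
  have Bm: "finite (B j)" "B j \<subseteq> moves (A j)" if "j \<in> {1..m}" for j
    using mb[OF that] by (simp_all add: markov_basis_def)
  have fin_basis: "finite (?Q \<union> ?L)"
    using finite_squarefree_deg2_moves finite_lifted_moves[OF Bm(1)] by blast
  have sub: "?Q \<union> ?L \<subseteq> moves (segre m A)"
  proof -
    have "?L \<subseteq> moves (segre m A)"
    proof
      fix u assume "u \<in> ?L"
      then obtain j z k where j: "j \<in> {1..m}" and z: "z \<in> B j"
        and k: "\<forall>h<deg (J j) z. k h \<in> other_indices m J j" and u: "u = lift_move (J j) j z k"
        unfolding lifted_moves_def by blast
      have zm: "z \<in> moves (A j)" using Bm(2)[OF j] z by blast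
      show "u \<in> moves (segre m A)"
        unfolding u
        by (rule lift_move_in_moves_segre[where A = A and J = J and j = j and z = z and k = k,
              OF _ hom[OF j] zm j k]) (rule cells)
    qed
    moreover have "?Q \<subseteq> moves (segre m A)"
      by (rule squarefree_moves_subset_moves_segre) (rule cells)
    ultimately show ?thesis by (rule Un_least[rotated])
  qed
  have walks: "(x, y) \<in> (step (fiber (segre m A) t) (?Q \<union> ?L))\<^sup>*"
    if x: "x \<in> fiber (segre m A) t" and y: "y \<in> fiber (segre m A) t" for t x y
  proof -
    obtain X where X: "set_mset X \<subseteq> mcells m J" "x = table_of X"
      using x mc tables_obtain_multiset[OF finite_mcells] by (metis (no_types, lifting) fiber_def mem_Collect_eq)
    obtain Y where Y: "set_mset Y \<subseteq> mcells m J" "y = table_of Y"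
      using y mc tables_obtain_multiset[OF finite_mcells] by (metis (no_types, lifting) fiber_def mem_Collect_eq)
    have marg_fiber: "table_of (marg j W) \<in> fiber (A j) (\<lambda>r. t (j, r))"
      if "set_mset W \<subseteq> mcells m J" "table_of W \<in> fiber (segre m A) t" and j: "j \<in> {1..m}" for W j
    proof -
      have W: "set_mset W \<subseteq> cells (segre m A)" using that(1) mc by simp
      have "mat_apply (A j) (table_of (marg j W)) r = t (j, r)" if "r \<in> rows (A j)" for r
        using mat_apply_segre[OF fin W j, of r] that \<open>table_of W \<in> fiber (segre m A) t\<close> j
        by (auto simp: fiber_def segre_def)
      then show ?thesis
        using table_of_in_tables[OF marg_in_cells[OF W j]] by (simp add: fiber_def)
    qed
    obtain X' where X': "set_mset X' \<subseteq> mcells m J" "\<And>j. j \<in> {1..m} \<Longrightarrow> marg j X' = marg j Y"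
      "(table_of X, table_of X') \<in> (step (tables (mcells m J)) ?L)\<^sup>*"
      using walk_to_prescribed_marginals[OF cells hom mb X(1) marg_fiber[OF X(1)] marg_fiber[OF Y(1)]]
        x y X(2) Y(2) by blast
    have "(table_of X', table_of Y) \<in> (step (tables (mcells m J)) ?Q)\<^sup>*"
      using walk_between_tables_with_equal_marginals[OF assms(1) X'(1) Y(1) X'(2)] .
    then have "(x, y) \<in> (step (tables (mcells m J)) (?Q \<union> ?L))\<^sup>*"
      unfolding X(2) Y(2)
      using walk_mono[OF X'(3), of "?Q \<union> ?L"] walk_mono[of "table_of X'" "table_of Y" _ ?Q "?Q \<union> ?L"]
      by (meson Un_upper1 Un_upper2 rtrancl_trans)
    then show ?thesis
      by (intro walk_in_tables_is_walk_in_fiber[OF sub _ x]) (simp only: mc)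
  qed
  show ?thesis
    unfolding L markov_basis_def
  proof (intro conjI allI ballI)
    show "finite (?Q \<union> ?L)" by (rule fin_basis)
    show "?Q \<union> ?L \<subseteq> moves (segre m A)" by (rule sub)
    show "(x, y) \<in> (step (fiber (segre m A) t) (?Q \<union> ?L))\<^sup>*"
      if "x \<in> fiber (segre m A) t" "y \<in> fiber (segre m A) t" for t x y
      using that by (rule walks)
  qed
qed

end
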